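(* Let $B_6=\left(\frac{-1,3}{\mathbb Q}\right)$ with $i^2=-1$, $j^2=3$, $ij=-ji$, and let $\mathcal O(6,1)=\mathbb Z+\mathbb Zi+\mathbb Zj+\mathbb Z\frac{1+i+j+ij}{2}$ (a maximal order). Then: (a) Among the index-$3$ sublattices of $\mathcal O(6,1)$ that are subrings (orders), exactly one has reduced discriminant $18$; call it $\mathcal O(6,3)$. It is stable under $\zeta_3=\tfrac12(-1+3i+j+ij)$ (i.e. under conjugation by $\zeta_3$). (b) Put $\mathcal O'(6,N)=\{\alpha\in\mathcal O(6,N):\operatorname{trd}(\alpha)\in2\mathbb Z\}$ for $N=1,3$. These are orders, of reduced discriminants $12$ and $36$ respectively. (c) For each of the four orders $\mathcal O$ in the list $\mathcal O(6,1),\ \mathcal O(6,3),\ \mathcal O'(6,1),\ \mathcal O'(6,3)$, with reduced discriminant $d(\mathcal O)=6,18,12,36$, the lattice of trace-zero elements of the dual lattice $\mathcal O^\sharp$, with the reduced-norm form scaled by $s=-d(\mathcal O)$, is an even ternary lattice in the genus of, respectively, $G_1,\ G_2,\ G_3,\ G_4$. Thus $$G_1\leftrightarrow\mathcal O(6,1),\quad G_2\leftrightarrow\mathcal O(6,3),\quad G_3\leftrightarrow\mathcal O'(6,1),\quad G_4\leftrightarrow\mathcal O'(6,3).$$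
   Context: $\operatorname{trd}$, $\operatorname{nrd}$ are the reduced trace and norm of $B_6$, and $\bar x$ is the standard involution. $\mathcal O^\sharp=\{x\in B_6:\operatorname{trd}(x\mathcal O)\subset\mathbb Z\}$. The scaled form on $(\mathcal O^\sharp)_0=\{x\in\mathcal O^\sharp:\operatorname{trd}x=0\}$ is the quadratic form $Q(x)=s\operatorname{nrd}(x)$, with Gram matrix $s\operatorname{trd}(x\bar y)$. The matrices $G_i$ are Gram matrices of even lattices $\mathbb Z^3$ of signature $(2,1)$: $$G_1=\begin{pmatrix}6&0&-3\\0&4&-2\\-3&-2&2\end{pmatrix},\ G_2=\begin{pmatrix}2&0&-3\\0&12&-6\\-3&-6&6\end{pmatrix},\ G_3=\begin{pmatrix}12&0&-6\\0&2&-2\\-6&-2&4\end{pmatrix},\ G_4=\begin{pmatrix}4&0&-6\\0&6&-6\\-6&-6&12\end{pmatrix}.$$ *)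

theory Defs
  imports "HOL-Analysis.Analysis" "HOL-Algebra.Ring" "HOL-Computational_Algebra.Primes"
begin

section \<open>The quaternion algebra (-1, 3 / Q)\<close>

text \<open>\<open>B6 a b c d\<close> is the quaternion $a + bi + cj + d\,ij$.\<close>

datatype b6 = B6 (cf1: rat) (cfi: rat) (cfj: rat) (cfk: rat)

instantiation b6 :: ring_1
begin

definition "0 = B6 0 0 0 0"
definition "1 = B6 1 0 0 0"
definition "x + y = B6 (cf1 x + cf1 y) (cfi x + cfi y) (cfj x + cfj y) (cfk x + cfk y)"
definition "- x = B6 (- cf1 x) (- cfi x) (- cfj x) (- cfk x)"
definition "x - y = B6 (cf1 x - cf1 y) (cfi x - cfi y) (cfj x - cfj y) (cfk x - cfk y)"

definition "x * y = B6
  (cf1 x * cf1 y - cfi x * cfi y + 3 * cfj x * cfj y + 3 * cfk x * cfk y)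
  (cf1 x * cfi y + cfi x * cf1 y - 3 * cfj x * cfk y + 3 * cfk x * cfj y)
  (cf1 x * cfj y + cfj x * cf1 y - cfi x * cfk y + cfk x * cfi y)
  (cf1 x * cfk y + cfk x * cf1 y + cfi x * cfj y - cfj x * cfi y)"

instance
  by standard
    (auto simp: zero_b6_def one_b6_def plus_b6_def uminus_b6_def minus_b6_def times_b6_def
      algebra_simps)

end

definition b6_of_rat :: "rat \<Rightarrow> b6" where
  "b6_of_rat r = B6 r 0 0 0"

definition qi :: b6 where "qi = B6 0 1 0 0"
definition qj :: b6 where "qj = B6 0 0 1 0"

lemma b6_relations: "qi * qi = - 1" "qj * qj = 3" "qi * qj = - (qj * qi)"
proof -
  have "(3::b6) = 1 + 1 + 1" by simp
  then show "qj * qj = 3"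
    by (simp add: one_b6_def plus_b6_def times_b6_def qj_def)
qed (simp_all add: one_b6_def uminus_b6_def times_b6_def qi_def qj_def)

lemma b6_expand:
  "B6 a b c d = b6_of_rat a + b6_of_rat b * qi + b6_of_rat c * qj + b6_of_rat d * (qi * qj)"
  by (simp add: b6_of_rat_def plus_b6_def times_b6_def qi_def qj_def)

definition qconj :: "b6 \<Rightarrow> b6" where
  "qconj x = B6 (cf1 x) (- cfi x) (- cfj x) (- cfk x)"

definition trd :: "b6 \<Rightarrow> rat" where
  "trd x = 2 * cf1 x"

definition nrd :: "b6 \<Rightarrow> rat" where
  "nrd x = (cf1 x)\<^sup>2 + (cfi x)\<^sup>2 - 3 * (cfj x)\<^sup>2 - 3 * (cfk x)\<^sup>2"

lemma trd_conj: "b6_of_rat (trd x) = x + qconj x"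
  by (simp add: b6_of_rat_def trd_def qconj_def plus_b6_def)

lemma nrd_conj: "b6_of_rat (nrd x) = x * qconj x" "b6_of_rat (nrd x) = qconj x * x"
  by (simp_all add: b6_of_rat_def nrd_def qconj_def times_b6_def power2_eq_square)

definition qinverse :: "b6 \<Rightarrow> b6" where
  "qinverse x = b6_of_rat (1 / nrd x) * qconj x"

lemma qinverse:
  assumes "nrd x \<noteq> 0"
  shows "x * qinverse x = 1" "qinverse x * x = 1"
proof -
  have "x * b6_of_rat r = b6_of_rat r * x" for r
    by (simp add: b6_of_rat_def times_b6_def)
  then have "x * qinverse x = b6_of_rat (1 / nrd x) * (x * qconj x)"
    by (metis qinverse_def mult.assoc)
  moreover have "qinverse x * x = b6_of_rat (1 / nrd x) * (qconj x * x)"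
    by (simp add: qinverse_def mult.assoc)
  moreover have "b6_of_rat (1 / nrd x) * b6_of_rat (nrd x) = 1"
    using assms by (simp add: b6_of_rat_def times_b6_def one_b6_def)
  ultimately show "x * qinverse x = 1" "qinverse x * x = 1"
    by (simp_all flip: nrd_conj)
qed


section \<open>Lattices and orders\<close>

text \<open>\<open>b\<close> is a \<open>\<int>\<close>-basis of \<open>L\<close>: every element of \<open>L\<close> is a unique integral combination.\<close>

definition zbasis :: "('n::finite \<Rightarrow> b6) \<Rightarrow> b6 set \<Rightarrow> bool" where
  "zbasis b L \<longleftrightarrow> bij_betw (\<lambda>c::'n \<Rightarrow> int. \<Sum>i\<in>UNIV. of_int (c i) * b i) UNIV L"

text \<open>An order is a subring that is a lattice of full rank 4.\<close>

definition is_order :: "b6 set \<Rightarrow> bool" where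
  "is_order R \<longleftrightarrow> (\<exists>e :: 4 \<Rightarrow> b6. zbasis e R) \<and> 1 \<in> R \<and> (\<forall>x\<in>R. \<forall>y\<in>R. x * y \<in> R)"

definition is_maximal_order :: "b6 set \<Rightarrow> bool" where
  "is_maximal_order R \<longleftrightarrow> is_order R \<and> (\<forall>S. is_order S \<and> R \<subseteq> S \<longrightarrow> S = R)"

text \<open>The number of additive cosets of \<open>L\<close> in \<open>M\<close> (0 if there are infinitely many).\<close>

definition lattice_index :: "b6 set \<Rightarrow> b6 set \<Rightarrow> nat" where
  "lattice_index M L = card ((\<lambda>x. (+) x ` L) ` M)"

text \<open>The reduced discriminant \<open>d\<close> is the positive square root of the discriminant
  $|\det(\mathrm{trd}(e_i e_j))|$, for any basis \<open>e\<close>.\<close>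

definition discrd :: "b6 set \<Rightarrow> nat" where
  "discrd R = (THE d. \<exists>e :: 4 \<Rightarrow> b6. zbasis e R \<and>
     (of_nat d)\<^sup>2 = \<bar>det (\<chi> i j. trd (e i * e j))\<bar>)"

definition dual :: "b6 set \<Rightarrow> b6 set" where
  "dual R = {x. \<forall>y\<in>R. trd (x * y) \<in> \<int>}"

definition dual0 :: "b6 set \<Rightarrow> b6 set" where
  "dual0 R = {x \<in> dual R. trd x = 0}"


section \<open>The four orders\<close>

definition O61 :: "b6 set" where
  "O61 = {of_int a + of_int b * qi + of_int c * qj
            + of_int d * (b6_of_rat (1/2) * (1 + qi + qj + qi * qj)) | a b c d :: int. True}"

definition zeta3 :: b6 where
  "zeta3 = b6_of_rat (1/2) * (- 1 + 3 * qi + qj + qi * qj)"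

definition O63 :: "b6 set" where
  "O63 = (THE L. L \<subseteq> O61 \<and> lattice_index O61 L = 3 \<and> is_order L \<and> discrd L = 18)"

definition even_trd :: "b6 set \<Rightarrow> b6 set" where
  "even_trd R = {x \<in> R. \<exists>n::int. trd x = 2 * of_int n}"

abbreviation O61' :: "b6 set" where "O61' \<equiv> even_trd O61"
abbreviation O63' :: "b6 set" where "O63' \<equiv> even_trd O63"


section \<open>Genera\<close>

text \<open>The ring of \<open>p\<close>-adic integers, as the inverse limit of the rings $\mathbb{Z}/p^n$: the
  \<open>n\<close>-th component is the residue in \<open>{0..<p^n}\<close>.\<close>

definition padic_integers :: "nat \<Rightarrow> (nat \<Rightarrow> int) ring" where
  "padic_integers p =
    \<lparr> carrier = {x. \<forall>n. x n \<in> {0..<int p ^ n} \<and> x (Suc n) mod int p ^ n = x n},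
      mult = (\<lambda>x y n. (x n * y n) mod int p ^ n),
      one = (\<lambda>n. 1 mod int p ^ n),
      zero = (\<lambda>n. 0),
      add = (\<lambda>x y n. (x n + y n) mod int p ^ n) \<rparr>"

lemma padic_integers_cring:
  assumes "p > 0"
  shows "cring (padic_integers p)"
proof -
  have pos: "int p ^ n > 0" for n using assms by simp
  note [simp] = pos_mod_sign[OF pos] pos_mod_bound[OF pos]
  have d: "int p ^ n dvd int p ^ Suc n" for n by simp
  have mm: "a mod int p ^ Suc n mod int p ^ n = a mod int p ^ n" for a n
    using d mod_mod_cancel by blast
  have plus: "(x (Suc n) + y (Suc n)) mod int p ^ n = (x n + y n) mod int p ^ n"
    if "x (Suc n) mod int p ^ n = x n" "y (Suc n) mod int p ^ n = y n" for x y n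
    using that by (metis mod_add_eq)
  have times: "(x (Suc n) * y (Suc n)) mod int p ^ n = (x n * y n) mod int p ^ n"
    if "x (Suc n) mod int p ^ n = x n" "y (Suc n) mod int p ^ n = y n" for x y n
    using that by (metis mod_mult_eq)
  have neg: "(- x (Suc n)) mod int p ^ n = (- x n) mod int p ^ n"
    if "x (Suc n) mod int p ^ n = x n" for x n
    using that by (metis mod_minus_eq)
  show ?thesis
  proof (intro cringI abelian_groupI comm_monoidI)
    fix x assume x: "x \<in> carrier (padic_integers p)"
    show "\<exists>y\<in>carrier (padic_integers p). y \<oplus>\<^bsub>padic_integers p\<^esub> x = \<zero>\<^bsub>padic_integers p\<^esub>"
      using x
      by (intro bexI[of _ "\<lambda>n. (- x n) mod int p ^ n"])
        (auto simp: padic_integers_def assms mm neg mod_simps simp del: power_Suc)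
  qed (auto simp: padic_integers_def fun_eq_iff assms mm plus times algebra_simps mod_simps
       simp del: power_Suc)
qed

text \<open>Congruence of integral Gram matrices after base change to \<open>R\<close>, by a matrix \<open>U\<close> that is
  invertible over \<open>R\<close> (with inverse \<open>V\<close>); \<open>add_pow R z \<one>\<^bsub>R\<^esub>\<close> is the image of the integer \<open>z\<close> in \<open>R\<close>.\<close>

definition congruent_over :: "('r, 'm) ring_scheme \<Rightarrow> int^'n^'n \<Rightarrow> int^'n^'n \<Rightarrow> bool" where
  "congruent_over R A B \<longleftrightarrow>
    (\<exists>U V :: 'n \<Rightarrow> 'n \<Rightarrow> 'r.
      (\<forall>i j. U i j \<in> carrier R \<and> V i j \<in> carrier R) \<and>
      (\<forall>i j. (\<Oplus>\<^bsub>R\<^esub>k\<in>UNIV. U i k \<otimes>\<^bsub>R\<^esub> V k j) = (if i = j then \<one>\<^bsub>R\<^esub> else \<zero>\<^bsub>R\<^esub>)) \<and>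
      (\<forall>i j. (\<Oplus>\<^bsub>R\<^esub>k\<in>UNIV. V i k \<otimes>\<^bsub>R\<^esub> U k j) = (if i = j then \<one>\<^bsub>R\<^esub> else \<zero>\<^bsub>R\<^esub>)) \<and>
      (\<forall>i j. (\<Oplus>\<^bsub>R\<^esub>k\<in>UNIV. \<Oplus>\<^bsub>R\<^esub>l\<in>UNIV. U k i \<otimes>\<^bsub>R\<^esub> add_pow R (A $ k $ l) \<one>\<^bsub>R\<^esub> \<otimes>\<^bsub>R\<^esub> U l j)
             = add_pow R (B $ i $ j) \<one>\<^bsub>R\<^esub>))"

definition real_ring :: "real ring" where
  "real_ring = \<lparr> carrier = UNIV, mult = (*), one = 1, zero = 0, add = (+) \<rparr>"

lemma real_ring_cring: "cring real_ring"
proof (intro cringI abelian_groupI comm_monoidI)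
  fix x assume "x \<in> carrier real_ring"
  show "\<exists>y\<in>carrier real_ring. y \<oplus>\<^bsub>real_ring\<^esub> x = \<zero>\<^bsub>real_ring\<^esub>"
    by (intro bexI[of _ "- x"]) (auto simp: real_ring_def)
qed (auto simp: real_ring_def algebra_simps)

definition same_genus :: "int^'n^'n \<Rightarrow> int^'n^'n \<Rightarrow> bool" where
  "same_genus A B \<longleftrightarrow>
     congruent_over real_ring A B \<and>
     (\<forall>p. prime p \<longrightarrow> congruent_over (padic_integers p) A B)"

text \<open>\<open>A\<close> is the Gram matrix of the quadratic form \<open>x \<mapsto> s * nrd x\<close> in the basis \<open>b\<close>; the bilinear form
  is normalized so that \<open>A $ i $ i\<close> is twice the value of the quadratic form at \<open>b i\<close>.\<close>

definition is_gram :: "rat \<Rightarrow> ('n::finite \<Rightarrow> b6) \<Rightarrow> int^'n^'n \<Rightarrow> bool" where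
  "is_gram s b A \<longleftrightarrow> (\<forall>i j. of_int (A $ i $ j) = s * trd (b i * qconj (b j)))"

text \<open>\<open>L\<close> with the form \<open>s * nrd\<close> is an even ternary lattice in the genus of \<open>G\<close>.\<close>

definition even_ternary_in_genus :: "b6 set \<Rightarrow> rat \<Rightarrow> int^3^3 \<Rightarrow> bool" where
  "even_ternary_in_genus L s G \<longleftrightarrow>
     (\<exists>(b :: 3 \<Rightarrow> b6) A. zbasis b L \<and> is_gram s b A \<and> (\<forall>i. even (A $ i $ i)) \<and> same_genus A G)"

definition G1 :: "int^3^3" where
  "G1 = vector [vector [6, 0, -3], vector [0, 4, -2], vector [-3, -2, 2]]"
definition G2 :: "int^3^3" where
  "G2 = vector [vector [2, 0, -3], vector [0, 12, -6], vector [-3, -6, 6]]"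
definition G3 :: "int^3^3" where
  "G3 = vector [vector [12, 0, -6], vector [0, 2, -2], vector [-6, -2, 4]]"
definition G4 :: "int^3^3" where
  "G4 = vector [vector [4, 0, -6], vector [0, 6, -6], vector [-6, -6, 12]]"

end

theory Submission
  imports Defs
begin

text \<open>The four orders are the lattices spanned by $1,\ mi,\ j,\ t(1+mi+j+ij)/2$ with
  \<open>m\<close> in \<open>{1, 3}\<close> and \<open>t\<close> in \<open>{1, 2}\<close>, of reduced discriminant \<open>6mt\<close>. The trace-zero part of the dual has
  the basis $-(i+j)/(2m),\ -ij/(3t),\ (j+ij)/6$, whose Gram matrix for the form scaled by \<open>-6mt\<close> is
  the given matrix itself, so each lattice is isometric to the given one already over the integers.

  An order containing \<open>O61\<close> has integral norms and lies in the dual of \<open>O61\<close>; congruences modulo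
  3 and 4 then force its elements into \<open>O61\<close>. A sublattice of index 3 contains \<open>3 O61\<close>, so the index-3
  subrings can be found by computing modulo 3.\<close>

section \<open>Coordinates\<close>

lemma coeff_simps [simp]:
  "cf1 0 = 0" "cfi 0 = 0" "cfj 0 = 0" "cfk 0 = 0"
  "cf1 1 = 1" "cfi 1 = 0" "cfj 1 = 0" "cfk 1 = 0"
  "cf1 (x + y) = cf1 x + cf1 y" "cfi (x + y) = cfi x + cfi y"
  "cfj (x + y) = cfj x + cfj y" "cfk (x + y) = cfk x + cfk y"
  "cf1 (x - y) = cf1 x - cf1 y" "cfi (x - y) = cfi x - cfi y"
  "cfj (x - y) = cfj x - cfj y" "cfk (x - y) = cfk x - cfk y"
  "cf1 (- x) = - cf1 x" "cfi (- x) = - cfi x" "cfj (- x) = - cfj x" "cfk (- x) = - cfk x"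
  by (simp_all add: zero_b6_def one_b6_def plus_b6_def minus_b6_def uminus_b6_def)

lemma of_int_b6: "of_int n = B6 (of_int n) 0 0 0"
  by (induction n rule: int_induct[where k = 0])
    (simp_all add: zero_b6_def one_b6_def plus_b6_def minus_b6_def)

lemma numeral_b6: "numeral n = B6 (numeral n) 0 0 0"
  using of_int_b6[of "numeral n"] by simp

lemma of_int_mult_b6:
  "of_int n * x = B6 (of_int n * cf1 x) (of_int n * cfi x) (of_int n * cfj x) (of_int n * cfk x)"
  by (simp add: of_int_b6 times_b6_def)

lemma coeff_sum:
  "cf1 (\<Sum>i\<in>A. f i) = (\<Sum>i\<in>A. cf1 (f i))" "cfi (\<Sum>i\<in>A. f i) = (\<Sum>i\<in>A. cfi (f i))"
  "cfj (\<Sum>i\<in>A. f i) = (\<Sum>i\<in>A. cfj (f i))" "cfk (\<Sum>i\<in>A. f i) = (\<Sum>i\<in>A. cfk (f i))"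
  by (induction A rule: infinite_finite_induct; simp)+

text \<open>The inner factor \<open>y * qconj y\<close> of \<open>x * y * qconj (x * y)\<close> is a
  rational scalar, hence central, and can be pulled out.\<close>

lemma nrd_mult: "nrd (x * y) = nrd x * nrd y"
proof -
  have "qconj (x * y) = qconj y * qconj x"
    by (simp add: qconj_def times_b6_def)
  then have "b6_of_rat (nrd (x * y)) = x * (y * qconj y) * qconj x"
    by (simp add: nrd_conj mult.assoc)
  also have "\<dots> = b6_of_rat (nrd y) * (x * qconj x)"
    unfolding nrd_conj(1)[of y, symmetric] by (simp add: b6_of_rat_def times_b6_def algebra_simps)
  also have "\<dots> = b6_of_rat (nrd x * nrd y)"
    unfolding nrd_conj(1)[of x, symmetric] by (simp add: b6_of_rat_def times_b6_def)
  finally show ?thesis by (simp add: b6_of_rat_def)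
qed

lemma nrd_power: "nrd (x ^ n) = nrd x ^ n"
  by (induction n) (simp_all add: nrd_mult, simp add: nrd_def)

lemma trd_of_int_mult: "trd (of_int n * x) = of_int n * trd x"
  by (simp add: trd_def of_int_mult_b6)

lemma trd_sum: "trd (\<Sum>i\<in>A. f i) = (\<Sum>i\<in>A. trd (f i))"
  by (simp add: trd_def coeff_sum sum_distrib_left)

section \<open>Lattices\<close>

text \<open>By additivity, uniqueness of coefficients reduces to a trivial kernel.\<close>

lemma zbasisI:
  assumes "L = range (\<lambda>c :: 'n::finite \<Rightarrow> int. \<Sum>i\<in>UNIV. of_int (c i) * b i)"
    and "\<And>c :: 'n \<Rightarrow> int. (\<Sum>i\<in>UNIV. of_int (c i) * b i) = 0 \<Longrightarrow> c = (\<lambda>_. 0)"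
  shows "zbasis b L"
  unfolding zbasis_def bij_betw_def
proof
  show "inj (\<lambda>c :: 'n \<Rightarrow> int. \<Sum>i\<in>UNIV. of_int (c i) * b i)"
  proof (rule injI)
    fix c d :: "'n \<Rightarrow> int"
    assume "(\<Sum>i\<in>UNIV. of_int (c i) * b i) = (\<Sum>i\<in>UNIV. of_int (d i) * b i)"
    then have "(\<Sum>i\<in>UNIV. of_int (c i - d i) * b i) = 0"
      by (simp add: left_diff_distrib sum_subtractf)
    from assms(2)[OF this] show "c = d" by (auto simp: fun_eq_iff)
  qed
qed (use assms(1) in simp)

lemma zbasis_range:
  assumes "zbasis b L"
  shows "L = range (\<lambda>c :: 'n::finite \<Rightarrow> int. \<Sum>i\<in>UNIV. of_int (c i) * b i)"
  using assms by (auto simp: zbasis_def bij_betw_def)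

lemma zbasis_expand:
  fixes b :: "'n::finite \<Rightarrow> b6"
  assumes "zbasis b L" "x \<in> L"
  obtains c where "x = (\<Sum>i\<in>UNIV. of_int (c i) * b i)"
  using assms zbasis_range by blast

lemma zbasis_sum_mem:
  assumes "zbasis b L"
  shows "(\<Sum>i\<in>UNIV. of_int (c i) * b i) \<in> L"
  unfolding zbasis_range[OF assms] by (rule rangeI)

lemma zbasis_mem:
  fixes b :: "'n::finite \<Rightarrow> b6"
  assumes "zbasis b L"
  shows "b i \<in> L"
proof -
  have "b i = (\<Sum>k\<in>UNIV. of_int (if k = i then 1 else 0) * b k)"
    by (subst sum.remove[of _ i]) auto
  then show ?thesis using zbasis_sum_mem[OF assms] by metis
qed

lemma zbasis_diff:
  fixes b :: "'n::finite \<Rightarrow> b6"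
  assumes "zbasis b L" "x \<in> L" "y \<in> L"
  shows "x - y \<in> L"
proof -
  obtain c d where "x = (\<Sum>i\<in>UNIV. of_int (c i) * b i)" "y = (\<Sum>i\<in>UNIV. of_int (d i) * b i)"
    using assms zbasis_expand by metis
  then have "x - y = (\<Sum>i\<in>UNIV. of_int (c i - d i) * b i)"
    by (simp add: left_diff_distrib sum_subtractf)
  then show ?thesis using zbasis_sum_mem[OF assms(1)] by metis
qed

section \<open>Gram determinants and the reduced discriminant\<close>

lemma det_of_int: "det (\<chi> i j. of_int (f i j)) = (of_int (det (\<chi> i j. f i j)) :: 'a::comm_ring_1)"
  by (simp add: det_def of_int_sum of_int_prod)

text \<open>Writing \<open>b'\<close> in terms of \<open>b\<close> by an integer matrix
  \<open>P\<close> turns the trace Gram matrix \<open>G\<close> into \<open>P G P^T\<close>, so its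
  determinant is multiplied by \<open>(det P)^2\<close>.\<close>

lemma zbasis_det_multiple:
  fixes b b' :: "'n::finite \<Rightarrow> b6"
  assumes "zbasis b L" "zbasis b' L"
  obtains p :: int where
    "det (\<chi> i j. trd (b' i * b' j)) = (of_int p)\<^sup>2 * det (\<chi> i j. trd (b i * b j))"
proof -
  have "\<exists>c. b' i = (\<Sum>k\<in>UNIV. of_int (c k) * b k)" for i
    using zbasis_expand[OF assms(1) zbasis_mem[OF assms(2)]] by metis
  then obtain P where P: "\<And>i. b' i = (\<Sum>k\<in>UNIV. of_int (P i k) * b k)" by metis
  let ?P = "\<chi> i j. (of_int (P i j) :: rat)"
  let ?G = "\<chi> i j. trd (b i * b j)"
  have scale: "(of_int m * x) * (of_int n * y) = of_int (m * n) * (x * y)" for x y :: b6 and m n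
    by (simp add: of_int_b6 times_b6_def algebra_simps)
  have "trd (b' i * b' j) = (\<Sum>l\<in>UNIV. (\<Sum>k\<in>UNIV. of_int (P i k) * trd (b k * b l)) * of_int (P j l))"
    for i j
  proof -
    have "b' i * b' j
        = (\<Sum>k\<in>UNIV. \<Sum>l\<in>UNIV. of_int (P i k * P j l) * (b k * b l))"
      unfolding P sum_product scale ..
    then have "trd (b' i * b' j)
        = (\<Sum>k\<in>UNIV. \<Sum>l\<in>UNIV. of_int (P i k) * trd (b k * b l) * of_int (P j l))"
      by (simp only: trd_sum trd_of_int_mult of_int_mult mult.assoc) (simp only: mult.commute)
    then show ?thesis
      by (subst (asm) sum.swap) (simp add: sum_distrib_right)
  qed
  then have "(\<chi> i j. trd (b' i * b' j)) = ?P ** ?G ** transpose ?P"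
    by (simp add: matrix_matrix_mult_def transpose_def vec_eq_iff)
  then have "det (\<chi> i j. trd (b' i * b' j)) = (det ?P)\<^sup>2 * det ?G"
    by (simp add: det_mul power2_eq_square)
  then show thesis unfolding det_of_int by (rule that)
qed

text \<open>The change-of-basis factors in the two directions are squares of integers. If the
  determinant is nonzero their product is 1, so each of them is 1; a zero determinant is
  immediate.\<close>

lemma zbasis_det_unique:
  fixes b b' :: "'n::finite \<Rightarrow> b6"
  assumes "zbasis b L" "zbasis b' L"
  shows "det (\<chi> i j. trd (b' i * b' j)) = det (\<chi> i j. trd (b i * b j))" (is "?d' = ?d")
proof -
  obtain p where p: "?d' = (of_int p)\<^sup>2 * ?d" using zbasis_det_multiple[OF assms] by metis
  obtain q where q: "?d = (of_int q)\<^sup>2 * ?d'" using zbasis_det_multiple[OF assms(2,1)] by metis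
  show ?thesis
  proof (cases "?d = 0")
    case False
    have "?d = (of_int (p * q))\<^sup>2 * ?d" using p q by (simp add: power_mult_distrib)
    then have "(of_int ((p * q)\<^sup>2) :: rat) = of_int 1" using False by simp
    then have "(p * q)\<^sup>2 = 1" by (simp only: of_int_eq_iff)
    then have "p dvd 1" by (metis dvd_triv_left dvd_mult2 power2_eq_square)
    then have "p\<^sup>2 = 1" by (auto simp: zdvd1_eq abs_if power2_eq_square split: if_splits)
    then show ?thesis using p by (simp flip: of_int_power)
  qed (use p in simp)
qed

text \<open>Independence of the basis makes the definite description in \<open>discrd\<close>
  computable from any single basis.\<close>

lemma discrdI:
  fixes e :: "4 \<Rightarrow> b6"
  assumes "zbasis e R" "\<bar>det (\<chi> i j. trd (e i * e j))\<bar> = (of_nat d)\<^sup>2"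
  shows "discrd R = d"
  unfolding discrd_def
proof (rule the_equality)
  fix d' assume "\<exists>e :: 4 \<Rightarrow> b6. zbasis e R \<and> (of_nat d')\<^sup>2 = \<bar>det (\<chi> i j. trd (e i * e j))\<bar>"
  then have "(of_nat d' :: rat)\<^sup>2 = (of_nat d)\<^sup>2"
    using assms zbasis_det_unique[OF assms(1)] by metis
  then show "d' = d" by (simp flip: of_nat_power)
qed (use assms in auto)

section \<open>Integrality of norms and traces in orders\<close>

lemma common_denominator:
  assumes "finite (F :: rat set)"
  shows "\<exists>N :: int. N \<noteq> 0 \<and> (\<forall>r\<in>F. of_int N * r \<in> \<int>)"
  using assms
proof (induction F)
  case empty
  show ?case by (auto intro: exI[of _ 1])
next
  case (insert r F)
  then obtain N :: int where N: "N \<noteq> 0" "\<forall>r\<in>F. of_int N * r \<in> \<int>" by auto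
  obtain a b where ab: "quotient_of r = (a, b)" by force
  have b: "b \<noteq> 0" using quotient_of_denom_pos[OF ab] by simp
  then have "of_int (b * N) * r = of_int (a * N)"
    using quotient_of_div[OF ab] by simp
  moreover have "of_int (b * N) * s = of_int b * (of_int N * s)" for s :: rat by simp
  ultimately show ?case using N b
    by (metis Ints_mult Ints_of_int insert_iff mult_eq_0_iff)
qed

text \<open>In lowest terms \<open>r = a / b\<close>, every power of \<open>b\<close> divides
  \<open>N\<close>. A denominator of at least 2 is excluded by the exponent
  \<open>\<bar>N\<bar>\<close>, because \<open>2 ^ \<bar>N\<bar>\<close> exceeds
  \<open>\<bar>N\<bar>\<close>.\<close>

lemma Ints_if_bounded_denominators:
  assumes "N \<noteq> 0" "\<And>n. of_int N * (r :: rat) ^ n \<in> \<int>"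
  shows "r \<in> \<int>"
proof -
  obtain a b where ab: "quotient_of r = (a, b)" by force
  have b: "b > 0" "coprime a b" "r = of_int a / of_int b"
    using quotient_of_denom_pos[OF ab] quotient_of_coprime[OF ab] quotient_of_div[OF ab] by auto
  have "b ^ n dvd N" for n
  proof -
    obtain z where "of_int N * r ^ n = of_int z" using assms(2) Ints_cases by metis
    then have "of_int (N * a ^ n) = (of_int (z * b ^ n) :: rat)"
      using b by (simp add: power_divide field_simps)
    then have "b ^ n dvd N * a ^ n" by (simp only: of_int_eq_iff) simp
    then show ?thesis using b(2) by (simp add: coprime_commute coprime_dvd_mult_left_iff)
  qed
  then have le: "b ^ n \<le> \<bar>N\<bar>" for n
    using assms(1) by (simp add: zdvd_imp_le)
  have "b = 1"
  proof (rule ccontr)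
    assume "b \<noteq> 1"
    then have "2 ^ nat \<bar>N\<bar> \<le> b ^ nat \<bar>N\<bar>" using b(1) by (intro power_mono) auto
    moreover have "int (nat \<bar>N\<bar>) < 2 ^ nat \<bar>N\<bar>" by (rule of_nat_less_two_power)
    ultimately show False using le[of "nat \<bar>N\<bar>"] by simp
  qed
  then show ?thesis using b(3) by simp
qed

lemma zbasis_common_denominator:
  fixes e :: "'n::finite \<Rightarrow> b6"
  assumes "zbasis e L"
  obtains N :: int where "N \<noteq> 0" "\<And>x. x \<in> L \<Longrightarrow>
    of_int N * cf1 x \<in> \<int> \<and> of_int N * cfi x \<in> \<int> \<and> of_int N * cfj x \<in> \<int> \<and> of_int N * cfk x \<in> \<int>"
proof -
  let ?F = "range (\<lambda>i. cf1 (e i)) \<union> range (\<lambda>i. cfi (e i)) \<union> range (\<lambda>i. cfj (e i)) \<union> range (\<lambda>i. cfk (e i))"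
  have "finite ?F" by simp
  from common_denominator[OF this]
  obtain N :: int where N: "N \<noteq> 0" "\<forall>r\<in>?F. of_int N * r \<in> \<int>" by blast
  have "of_int N * cf1 x \<in> \<int> \<and> of_int N * cfi x \<in> \<int> \<and> of_int N * cfj x \<in> \<int> \<and> of_int N * cfk x \<in> \<int>"
    if x: "x \<in> L" for x
  proof -
    obtain c where c: "x = (\<Sum>i\<in>UNIV. of_int (c i) * e i)"
      by (rule zbasis_expand[OF assms x])
    have int: "of_int N * (\<Sum>i\<in>UNIV. of_int (c i) * f (e i)) \<in> \<int>"
      if "\<And>i. of_int N * f (e i) \<in> \<int>" for f :: "b6 \<Rightarrow> rat"
    proof -
      have "of_int N * (\<Sum>i\<in>UNIV. of_int (c i) * f (e i)) = (\<Sum>i\<in>UNIV. of_int (c i) * (of_int N * f (e i)))"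
        by (simp add: sum_distrib_left mult.left_commute)
      then show ?thesis using that by (simp add: Ints_sum Ints_mult)
    qed
    have "of_int N * cf1 (e i) \<in> \<int>" "of_int N * cfi (e i) \<in> \<int>"
      "of_int N * cfj (e i) \<in> \<int>" "of_int N * cfk (e i) \<in> \<int>" for i
      using N(2) by blast+
    then show ?thesis by (simp add: c coeff_sum of_int_mult_b6 int)
  qed
  then show thesis using N(1) that by blast
qed

text \<open>The powers of an element of an order have bounded denominators, hence so do those of its norm.\<close>

lemma nrd_order:
  assumes "is_order S" "x \<in> S"
  shows "nrd x \<in> \<int>"
proof -
  obtain e :: "4 \<Rightarrow> b6" where "zbasis e S" using assms(1) by (auto simp: is_order_def)
  then obtain N :: int where N: "N \<noteq> 0" "\<And>y. y \<in> S \<Longrightarrow>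
      of_int N * cf1 y \<in> \<int> \<and> of_int N * cfi y \<in> \<int> \<and> of_int N * cfj y \<in> \<int> \<and> of_int N * cfk y \<in> \<int>"
    using zbasis_common_denominator by metis
  \<comment> \<open>\<open>N\<close> clears the coordinates of every power of \<open>x\<close>; the
    norm is quadratic in them, so \<open>N\<close> squared clears the norm.\<close>
  have "of_int (N\<^sup>2) * nrd x ^ n \<in> \<int>" for n
  proof -
    have "x ^ n \<in> S" using assms by (induction n) (auto simp: is_order_def)
    moreover have "of_int (N\<^sup>2) * nrd y =
      (of_int N * cf1 y)\<^sup>2 + (of_int N * cfi y)\<^sup>2 - 3 * (of_int N * cfj y)\<^sup>2 - 3 * (of_int N * cfk y)\<^sup>2"
      for y by (simp add: nrd_def power_mult_distrib algebra_simps)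
    ultimately show ?thesis
      using N(2)[of "x ^ n"] by (simp add: nrd_power[symmetric] del: of_int_power)
  qed
  moreover have "N\<^sup>2 \<noteq> 0" using N(1) by simp
  ultimately show ?thesis using Ints_if_bounded_denominators by blast
qed

text \<open>The trace is the polarization of the norm at \<open>x\<close> and 1, so integrality of
  norms suffices.\<close>

lemma trd_order:
  assumes "is_order S" "x \<in> S"
  shows "trd x \<in> \<int>"
proof -
  obtain e :: "4 \<Rightarrow> b6" where e: "zbasis e S" using assms(1) by (auto simp: is_order_def)
  have "x - 1 \<in> S" using zbasis_diff[OF e] assms by (auto simp: is_order_def)
  moreover have "trd x = nrd x + 1 - nrd (x - 1)"
    by (simp add: trd_def nrd_def power2_eq_square algebra_simps)
  ultimately show ?thesis using nrd_order assms by simp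
qed

section \<open>Genera\<close>

text \<open>The identity matrix serves as both \<open>U\<close> and \<open>V\<close>;
  \<open>sl\<close> and \<open>sr\<close> collapse sums against it from the left and from the
  right.\<close>

lemma (in cring) congruent_over_refl:
  fixes A :: "int^'n^'n"
  shows "congruent_over R A A"
proof -
  define I where "I i j = (if i = j then \<one> else \<zero>)" for i j :: 'n
  have sl: "(\<Oplus>k\<in>UNIV. I i k \<otimes> f k) = f i" if "\<And>k. f k \<in> carrier R" for i :: 'n and f
  proof -
    have "(\<Oplus>k\<in>UNIV. I i k \<otimes> f k) = (\<Oplus>k\<in>UNIV. if i = k then f k else \<zero>)"
      using that by (intro add.finprod_cong') (auto simp: I_def)
    then show ?thesis using that add.finprod_singleton[of i UNIV f] by simp
  qed
  have sr: "(\<Oplus>k\<in>UNIV. f k \<otimes> I k j) = f j" if "\<And>k. f k \<in> carrier R" for j :: 'n and f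
  proof -
    have "(\<Oplus>k\<in>UNIV. f k \<otimes> I k j) = (\<Oplus>k\<in>UNIV. I j k \<otimes> f k)"
      using that by (intro add.finprod_cong') (auto simp: I_def)
    then show ?thesis using sl that by simp
  qed
  have I: "I i j \<in> carrier R" for i j by (simp add: I_def)
  have A: "add_pow R (A $ k $ l) \<one> \<in> carrier R" for k l by simp
  have "(\<Oplus>k\<in>UNIV. \<Oplus>l\<in>UNIV. I k i \<otimes> add_pow R (A $ k $ l) \<one> \<otimes> I l j) = add_pow R (A $ i $ j) \<one>"
    for i j
  proof -
    \<comment> \<open>The left factor of the congruence enters transposed, so symmetry of
      \<open>I\<close> is used before \<open>sl\<close> applies.\<close>
    have "I k i = I i k" for k by (auto simp: I_def)
    then show ?thesis using I A by (simp add: sl sr)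
  qed
  then show ?thesis
    unfolding congruent_over_def using I sl[of "\<lambda>k. I k j" for j] by (intro exI[of _ I]) (auto simp: I_def)
qed

lemma same_genus_refl: "same_genus A A"
  unfolding same_genus_def
  using cring.congruent_over_refl[OF real_ring_cring]
    cring.congruent_over_refl[OF padic_integers_cring] prime_gt_0_nat
  by blast

section \<open>The four orders and their duals\<close>

text \<open>With \<open>m\<close> in \<open>{1, 3}\<close> and \<open>t\<close> in \<open>{1, 2}\<close>, \<open>lat m t a b c d\<close> is the combination with
  coefficients \<open>a, b, c, d\<close> of $1,\ mi,\ j,\ t(1+mi+j+ij)/2$; the four orders are the spans
  of these quadruples.\<close>

definition lat :: "int \<Rightarrow> int \<Rightarrow> int \<Rightarrow> int \<Rightarrow> int \<Rightarrow> int \<Rightarrow> b6" where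
  "lat m t a b c d = B6 (of_int a + of_int (t * d) / 2) (of_int (m * b) + of_int (m * t * d) / 2)
     (of_int c + of_int (t * d) / 2) (of_int (t * d) / 2)"

definition ord :: "int \<Rightarrow> int \<Rightarrow> b6 set" where
  "ord m t = {lat m t a b c d | a b c d. True}"

lemma lat_mem_ord: "lat m t a b c d \<in> ord m t"
  by (auto simp: ord_def)

lemma lat_diff: "lat m t a b c d - lat m t a' b' c' d' = lat m t (a - a') (b - b') (c - c') (d - d')"
  by (simp add: lat_def minus_b6_def field_simps)

lemma O61_eq: "O61 = ord 1 1"
proof -
  have "of_int a + of_int b * qi + of_int c * qj
      + of_int d * (b6_of_rat (1/2) * (1 + qi + qj + qi * qj)) = lat 1 1 a b c d" for a b c d
    by (simp add: lat_def of_int_b6 b6_of_rat_def qi_def qj_def one_b6_def plus_b6_def times_b6_def)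
  then show ?thesis unfolding O61_def ord_def by simp
qed

text \<open>All integer divisions below are exact.\<close>

lemma lat_mult:
  fixes a b c d a' b' c' d' :: int
  assumes "m \<in> {1, 3}" "t \<in> {1, 2}"
  defines "h \<equiv> 2 div t" and "g \<equiv> (m - 3 div m) div 2"
    and "x \<equiv> (m + 1) div 2" and "y \<equiv> (1 - m) div 2" and "z \<equiv> (m + 3) div 2"
  shows "lat m t a b c d * lat m t a' b' c' d' = lat m t
    (a * a' - m\<^sup>2 * b * b' + 3 * c * c' - t\<^sup>2 * ((m\<^sup>2 - 5) div 4) * d * d' - m * (b * c' - c * b')
      - t * m * x * b * d' + (t * m * x - m\<^sup>2 * t) * d * b' + t * z * c * d' + (3 * t - t * z) * d * c')
    (a * b' + b * a' - m * (b * c' - c * b') + t * y * b * d' + (t - t * y) * d * b'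
      + t * g * (c * d' - d * c'))
    (a * c' + c * a' - m * (b * c' - c * b') - t * m * (b * d' - d * b') + t * x * c * d'
      + (t - t * x) * d * c')
    (a * d' + d * a' + m * h * (b * c' - c * b') + m * (b * d' - d * b') - m * (c * d' - d * c')
      + t * d * d')"
  \<comment> \<open>In each of the four cases for \<open>m\<close> and \<open>t\<close> the
    constants become numerals, leaving polynomial identities in the eight coordinates.\<close>
  using assms(1,2)
  apply (auto simp: assms(3-))
     apply (simp_all add: lat_def times_b6_def)
     apply (simp_all add: algebra_simps add_divide_distrib diff_divide_distrib)
  done

definition ord_basis :: "int \<Rightarrow> int \<Rightarrow> 4 \<Rightarrow> b6" where
  "ord_basis m t i =
    (if i = 1 then lat m t 1 0 0 0 else if i = 2 then lat m t 0 1 0 0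
     else if i = 3 then lat m t 0 0 1 0 else lat m t 0 0 0 1)"

lemma sum_ord_basis:
  "(\<Sum>i\<in>UNIV. of_int (c i) * ord_basis m t i) = lat m t (c 1) (c 2) (c 3) (c 4)"
  by (simp add: sum_4 ord_basis_def lat_def of_int_mult_b6 plus_b6_def)

lemma zbasis_ord:
  assumes "m \<noteq> 0" "t \<noteq> 0"
  shows "zbasis (ord_basis m t) (ord m t)"
proof (rule zbasisI)
  have "lat m t a b c d \<in> range (\<lambda>f :: 4 \<Rightarrow> int. lat m t (f 1) (f 2) (f 3) (f 4))" for a b c d
    by (rule range_eqI[of _ _ "\<lambda>i. if i = 1 then a else if i = 2 then b else if i = 3 then c else d"]) simp
  then show "ord m t = range (\<lambda>c. \<Sum>i\<in>UNIV. of_int (c i) * ord_basis m t i)"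
    unfolding sum_ord_basis ord_def by blast
next
  fix c :: "4 \<Rightarrow> int"
  assume "(\<Sum>i\<in>UNIV. of_int (c i) * ord_basis m t i) = 0"
  then have "c 1 = 0 \<and> c 2 = 0 \<and> c 3 = 0 \<and> c 4 = 0"
    unfolding sum_ord_basis using assms by (auto simp: lat_def zero_b6_def)
  then have "\<forall>i. c i = 0" by (simp add: forall_4)
  then show "c = (\<lambda>_. 0)" by auto
qed

text \<open>Laplace expansion along the first row. Each use of
  \<open>sum_over_permutations_insert\<close> peels one index off the sum over permutations, until
  only those of a singleton remain.\<close>

lemma det_4:
  "det (A :: 'a::comm_ring_1^4^4) =
    A$1$1 * (A$2$2 * (A$3$3 * A$4$4 - A$3$4 * A$4$3) - A$2$3 * (A$3$2 * A$4$4 - A$3$4 * A$4$2)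
      + A$2$4 * (A$3$2 * A$4$3 - A$3$3 * A$4$2))
    - A$1$2 * (A$2$1 * (A$3$3 * A$4$4 - A$3$4 * A$4$3) - A$2$3 * (A$3$1 * A$4$4 - A$3$4 * A$4$1)
      + A$2$4 * (A$3$1 * A$4$3 - A$3$3 * A$4$1))
    + A$1$3 * (A$2$1 * (A$3$2 * A$4$4 - A$3$4 * A$4$2) - A$2$2 * (A$3$1 * A$4$4 - A$3$4 * A$4$1)
      + A$2$4 * (A$3$1 * A$4$2 - A$3$2 * A$4$1))
    - A$1$4 * (A$2$1 * (A$3$2 * A$4$3 - A$3$3 * A$4$2) - A$2$2 * (A$3$1 * A$4$3 - A$3$3 * A$4$1)
      + A$2$3 * (A$3$1 * A$4$2 - A$3$2 * A$4$1))"
proof -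
  have f1: "finite {2::4, 3, 4}" "1 \<notin> {2::4, 3, 4}" by auto
  have f2: "finite {3::4, 4}" "2 \<notin> {3::4, 4}" by auto
  have f3: "finite {4::4}" "3 \<notin> {4::4}" by auto
  show ?thesis
    unfolding det_def UNIV_4
    unfolding sum_over_permutations_insert[OF f1]
    unfolding sum_over_permutations_insert[OF f2]
    unfolding sum_over_permutations_insert[OF f3]
    unfolding permutes_sing
    by (simp add: sign_swap_id permutation_swap_id permutation_compose sign_compose sign_id swap_id_eq algebra_simps)
qed

text \<open>The trace Gram determinant of 1, i, j, ij is -144. Passing to the basis of
  \<open>ord m t\<close> multiplies it by \<open>(m t / 2)^2\<close>, which gives
  \<open>-(6 m t)^2\<close>.\<close>

lemma discrd_ord:
  assumes "m \<in> {1, 3}" "t \<in> {1, 2}"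
  shows "discrd (ord m t) = nat (6 * m * t)"
proof (rule discrdI)
  show "zbasis (ord_basis m t) (ord m t)" using assms by (intro zbasis_ord) auto
  show "\<bar>det (\<chi> i j. trd (ord_basis m t i * ord_basis m t j))\<bar> = (of_nat (nat (6 * m * t)))\<^sup>2"
    using assms
    apply safe
       apply (simp_all only: det_4)
       apply (simp_all add: ord_basis_def lat_def)
       apply (simp_all add: times_b6_def trd_def)
    done
qed

lemma is_order_ord:
  assumes "m \<in> {1, 3}" "t \<in> {1, 2}"
  shows "is_order (ord m t)"
  unfolding is_order_def
proof (intro conjI ballI)
  have "zbasis (ord_basis m t) (ord m t)" using assms by (intro zbasis_ord) auto
  then show "\<exists>e :: 4 \<Rightarrow> b6. zbasis e (ord m t)" by blast
  have "1 = lat m t 1 0 0 0" by (simp add: lat_def one_b6_def)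
  then show "1 \<in> ord m t" by (metis lat_mem_ord)
  fix x y assume "x \<in> ord m t" "y \<in> ord m t"
  then obtain a b c d a' b' c' d' where "x = lat m t a b c d" "y = lat m t a' b' c' d'"
    unfolding ord_def by blast
  \<comment> \<open>The product coordinates given by \<open>lat_mult\<close> are integers, which is
    all that closure requires.\<close>
  then show "x * y \<in> ord m t" by (simp only: lat_mult[OF assms] lat_mem_ord)
qed

lemma trd_lat: "trd (lat m t a b c d) = of_int (2 * a + t * d)"
  by (simp add: trd_def lat_def)

text \<open>The trace is \<open>2 a + d\<close>, so evenness constrains only \<open>d\<close>;
  replacing \<open>d\<close> by \<open>2 d\<close> doubles the last basis vector, which is the
  passage from \<open>t = 1\<close> to \<open>t = 2\<close>.\<close>

lemma even_trd_ord: "even_trd (ord m 1) = ord m 2"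
proof -
  have "(\<exists>n. trd (lat m 1 a b c d) = 2 * of_int n) \<longleftrightarrow> even d" for a b c d
  proof -
    have "trd (lat m 1 a b c d) = 2 * of_int n \<longleftrightarrow> 2 * a + d = 2 * n" for n
      unfolding trd_lat by (simp flip: of_int_eq_iff[where ?'a = rat])
    then have "(\<exists>n. trd (lat m 1 a b c d) = 2 * of_int n) \<longleftrightarrow> even (2 * a + d)"
      by (simp add: dvd_def)
    then show ?thesis by simp
  qed
  moreover have "even_trd (ord m 1) =
      {lat m 1 a b c d | a b c d. \<exists>n :: int. trd (lat m 1 a b c d) = 2 * of_int n}"
    unfolding even_trd_def ord_def by blast
  ultimately have "even_trd (ord m 1) = {lat m 1 a b c d | a b c d. even d}" by simp
  also have "\<dots> = {lat m 1 a b c (2 * d) | a b c d. True}"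
    by (blast elim: evenE intro: dvd_triv_left)
  also have "\<dots> = ord m 2"
    unfolding ord_def by (simp add: lat_def)
  finally show ?thesis .
qed

section \<open>Trace-zero parts of the duals and their Gram matrices\<close>

definition dual0_basis :: "int \<Rightarrow> int \<Rightarrow> 3 \<Rightarrow> b6" where
  "dual0_basis m t i =
    (if i = 1 then B6 0 (- 1 / of_int (2 * m)) (- 1 / of_int (2 * m)) 0
     else if i = 2 then B6 0 0 0 (- 1 / of_int (3 * t)) else B6 0 0 (1/6) (1/6))"

definition dual0_lat :: "int \<Rightarrow> int \<Rightarrow> int \<Rightarrow> int \<Rightarrow> int \<Rightarrow> b6" where
  "dual0_lat m t a b c =
    B6 0 (- of_int a / of_int (2 * m)) (- of_int a / of_int (2 * m) + of_int c / 6)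
      (- of_int b / of_int (3 * t) + of_int c / 6)"

lemma sum_dual0_basis:
  "(\<Sum>i\<in>UNIV. of_int (c i) * dual0_basis m t i) = dual0_lat m t (c 1) (c 2) (c 3)"
  by (simp add: sum_3 dual0_basis_def dual0_lat_def of_int_mult_b6 plus_b6_def)

text \<open>Duality is tested on the basis of \<open>ord m t\<close>. A trace-zero element pairs to
  0 with 1, and its integral pairings with the other three basis vectors determine its
  coordinates.\<close>

lemma mem_dual0_ord:
  assumes "m \<in> {1, 3}" "t \<in> {1, 2}"
  shows "x \<in> dual0 (ord m t) \<longleftrightarrow> (\<exists>a b c. x = dual0_lat m t a b c)" (is "_ \<longleftrightarrow> ?R")
proof
  assume x: "x \<in> dual0 (ord m t)"
  then have int: "trd (x * lat m t a b c d) \<in> \<int>" for a b c d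
    using lat_mem_ord by (auto simp: dual0_def dual_def)
  obtain q r s where xB: "x = B6 0 q r s"
    using x by (cases x) (auto simp: dual0_def trd_def)
  have "- (2 * of_int m * q) = trd (x * lat m t 0 1 0 0)" "6 * r = trd (x * lat m t 0 0 1 0)"
    "of_int t * (3 * r + 3 * s - of_int m * q) = trd (x * lat m t 0 0 0 1)"
    by (simp_all add: xB lat_def times_b6_def trd_def field_simps)
  then obtain u v w where uvw: "- (2 * of_int m * q) = of_int u" "6 * r = of_int v"
    "of_int t * (3 * r + 3 * s - of_int m * q) = of_int w"
    using int by (metis Ints_cases)
  \<comment> \<open>The coefficients come from solving the three equations for \<open>q\<close>,
    \<open>r\<close>, \<open>s\<close> and comparing coordinates. The divisions are exact:
    \<open>3 div m\<close> is 3 or 1.\<close>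
  have "x = dual0_lat m t u (t * (v + (3 div m + 1) div 2 * u) - w) (v + 3 div m * u)"
    using assms uvw by (auto simp: xB dual0_lat_def field_simps)
  then show ?R by blast
next
  assume ?R
  then obtain a b c where x: "x = dual0_lat m t a b c" by blast
  \<comment> \<open>The same pairings in the other direction, now visibly integral;
    \<open>3 div m - 1\<close> is 2 or 0, so its half is exact.\<close>
  have "trd (x * lat m t a' b' c' d') = of_int (a * b' + (c - 3 div m * a) * c' +
      (t * (c - (3 div m - 1) div 2 * a) - b) * d')" for a' b' c' d'
    using assms by (auto simp: x dual0_lat_def lat_def times_b6_def trd_def field_simps)
  then have "trd (x * y) \<in> \<int>" if "y \<in> ord m t" for y
    using that by (auto simp: ord_def simp del: of_int_add of_int_mult)
  then show "x \<in> dual0 (ord m t)" by (simp add: dual0_def dual_def trd_def x dual0_lat_def)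
qed

lemma zbasis_dual0_ord:
  assumes "m \<in> {1, 3}" "t \<in> {1, 2}"
  shows "zbasis (dual0_basis m t) (dual0 (ord m t))"
proof (rule zbasisI)
  have "dual0_lat m t a b c \<in> range (\<lambda>f :: 3 \<Rightarrow> int. dual0_lat m t (f 1) (f 2) (f 3))" for a b c
    by (rule range_eqI[of _ _ "\<lambda>i. if i = 1 then a else if i = 2 then b else c"]) simp
  moreover have "dual0 (ord m t) = {dual0_lat m t a b c | a b c. True}"
    using mem_dual0_ord[OF assms] by blast
  ultimately show "dual0 (ord m t) = range (\<lambda>c. \<Sum>i\<in>UNIV. of_int (c i) * dual0_basis m t i)"
    unfolding sum_dual0_basis by auto
next
  fix c :: "3 \<Rightarrow> int"
  assume "(\<Sum>i\<in>UNIV. of_int (c i) * dual0_basis m t i) = 0"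
  then have "dual0_lat m t (c 1) (c 2) (c 3) = 0" unfolding sum_dual0_basis .
  moreover have "m \<noteq> 0" "t \<noteq> 0" using assms by auto
  \<comment> \<open>The system is triangular: the i coordinate gives \<open>c 1\<close>, then the j
    coordinate \<open>c 3\<close>, then the ij coordinate \<open>c 2\<close>.\<close>
  ultimately have "c 1 = 0" "c 3 = 0" "c 2 = 0"
    by (auto simp: zero_b6_def dual0_lat_def)
  then have "\<forall>i. c i = 0" by (simp add: forall_3)
  then show "c = (\<lambda>_. 0)" by auto
qed

text \<open>For a basis whose Gram matrix is literally \<open>G\<close>, the genus condition is
  reflexivity.\<close>

lemma even_ternary_in_genusI:
  assumes "zbasis b L" "is_gram s b G" "\<forall>i. even (G $ i $ i)"
  shows "even_ternary_in_genus L s G"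
  using assms same_genus_refl unfolding even_ternary_in_genus_def by blast

lemmas gram_simps = is_gram_def forall_3 dual0_basis_def qconj_def times_b6_def trd_def

text \<open>On trace-zero quaternions \<open>nrd\<close> has signature (1,2); the negative scale
  turns this into the signature (2,1) of the given matrices.\<close>

lemma genus_G1: "even_ternary_in_genus (dual0 (ord 1 1)) (- 6) G1"
  by (rule even_ternary_in_genusI[OF zbasis_dual0_ord]) (simp_all add: gram_simps G1_def)
lemma genus_G2: "even_ternary_in_genus (dual0 (ord 3 1)) (- 18) G2"
  by (rule even_ternary_in_genusI[OF zbasis_dual0_ord]) (simp_all add: gram_simps G2_def)
lemma genus_G3: "even_ternary_in_genus (dual0 (ord 1 2)) (- 12) G3"
  by (rule even_ternary_in_genusI[OF zbasis_dual0_ord]) (simp_all add: gram_simps G3_def)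
lemma genus_G4: "even_ternary_in_genus (dual0 (ord 3 2)) (- 36) G4"
  by (rule even_ternary_in_genusI[OF zbasis_dual0_ord]) (simp_all add: gram_simps G4_def)

section \<open>Maximality\<close>

text \<open>Squares modulo 3 are 0 or 1, so two of them cancel only if both vanish; equivalently, -1
  is not a square modulo 3.\<close>

lemma mod3_square_sum:
  fixes r t :: int
  assumes "3 dvd r\<^sup>2 + t\<^sup>2"
  shows "3 dvd r \<and> 3 dvd t"
proof -
  have sq: "x\<^sup>2 mod 3 = (if 3 dvd x then 0 else 1)" for x :: int
  proof -
    have "x mod 3 = 0 \<or> x mod 3 = 1 \<or> x mod 3 = 2" by presburger
    then have "(x mod 3)\<^sup>2 mod 3 = (if x mod 3 = 0 then 0 else 1)" by (elim disjE) simp_all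
    then show ?thesis by (simp only: power_mod dvd_eq_mod_eq_0)
  qed
  have "(r\<^sup>2 mod 3 + t\<^sup>2 mod 3) mod 3 = 0" using assms by (simp add: mod_add_eq dvd_eq_mod_eq_0)
  then show ?thesis by (simp add: sq split: if_splits)
qed

text \<open>Since -3 is 1 modulo 4, the form is congruent to a sum of four squares, and each square
  is congruent to its parity bit. Four bits add up to a multiple of 4 only if they are all
  equal.\<close>

lemma mod4_square_sum:
  fixes p q r t :: int
  assumes "4 dvd p\<^sup>2 + q\<^sup>2 - 3 * r\<^sup>2 - 3 * t\<^sup>2"
  shows "even (p - t) \<and> even (q - t) \<and> even (r - t)"
proof -
  have sq: "x\<^sup>2 mod 4 = x mod 2" for x :: int
  proof (cases "even x")
    case False
    then obtain y where "x = 2 * y + 1" by (elim oddE)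
    then have "x\<^sup>2 = 4 * (y\<^sup>2 + y) + 1" by (simp add: power2_eq_square algebra_simps)
    then have "x\<^sup>2 mod 4 = 1" by presburger
    then show ?thesis using False by presburger
  qed (auto elim!: evenE simp: power2_eq_square)
  have "x\<^sup>2 = 4 * (x\<^sup>2 div 4) + x mod 2" for x :: int
    using mult_div_mod_eq[of 4 "x\<^sup>2"] by (simp only: sq)
  then have "p mod 2 + q mod 2 + r mod 2 + t mod 2 = (p\<^sup>2 + q\<^sup>2 - 3 * r\<^sup>2 - 3 * t\<^sup>2)
      + 4 * (r\<^sup>2 + t\<^sup>2 - p\<^sup>2 div 4 - q\<^sup>2 div 4 - r\<^sup>2 div 4 - t\<^sup>2 div 4)"
    by (smt (verit) distrib_left right_diff_distrib)
  also have "4 dvd \<dots>" using assms by (intro dvd_add) auto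
  finally have dv: "4 dvd p mod 2 + q mod 2 + r mod 2 + t mod 2" .
  have bit: "x mod 2 = 0 \<or> x mod 2 = 1" for x :: int by presburger
  have "p mod 2 = t mod 2 \<and> q mod 2 = t mod 2 \<and> r mod 2 = t mod 2"
    using dv bit[of p] bit[of q] bit[of r] bit[of t] by (elim disjE) simp_all
  then show ?thesis by (simp only: mod_eq_dvd_iff)
qed

lemma is_maximal_order_ord: "is_maximal_order (ord 1 1)"
  unfolding is_maximal_order_def
proof (intro conjI allI impI)
  show "is_order (ord 1 1)" by (simp add: is_order_ord)
  fix S assume S: "is_order S \<and> ord 1 1 \<subseteq> S"
  have "x \<in> ord 1 1" if "x \<in> S" for x
  proof -
    obtain p q r s where x: "x = B6 p q r s" by (cases x)
    \<comment> \<open>The product stays in the larger order \<open>S\<close>, so its trace is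
      integral: \<open>x\<close> lies in the dual of \<open>ord 1 1\<close>.\<close>
    have "trd (x * lat 1 1 a b c d) \<in> \<int>" for a b c d
      using S that lat_mem_ord trd_order[of S] unfolding is_order_def by blast
    moreover have "2 * p = trd (x * lat 1 1 1 0 0 0)" "- (2 * q) = trd (x * lat 1 1 0 1 0 0)"
      "6 * r = trd (x * lat 1 1 0 0 1 0)" "p - q + 3 * r + 3 * s = trd (x * lat 1 1 0 0 0 1)"
      by (simp_all add: x lat_def times_b6_def trd_def field_simps)
    ultimately obtain P Q R W where
      int: "2 * p = of_int P" "- (2 * q) = of_int Q" "6 * r = of_int R" "p - q + 3 * r + 3 * s = of_int W"
      by (metis Ints_cases)
    \<comment> \<open>\<open>T\<close> is \<open>6 s\<close>, obtained by eliminating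
      \<open>p\<close>, \<open>q\<close>, \<open>r\<close> from the pairing
      \<open>W\<close>.\<close>
    define T where "T = 2 * W - P - Q - R"
    have coords: "p = of_int P / 2" "q = - of_int Q / 2" "r = of_int R / 6" "s = of_int T / 6"
      using int by (simp_all add: T_def)
    have "nrd x \<in> \<int>" using nrd_order S that by blast
    then obtain K where "nrd x = of_int K" by (rule Ints_cases)
    then have "of_int (3 * P\<^sup>2 + 3 * Q\<^sup>2 - R\<^sup>2 - T\<^sup>2) = (of_int (12 * K) :: rat)"
      by (simp add: nrd_def x coords power_divide field_simps)
    then have K: "3 * P\<^sup>2 + 3 * Q\<^sup>2 - R\<^sup>2 - T\<^sup>2 = 12 * K" by (simp only: of_int_eq_iff)
    \<comment> \<open>Modulo 3 the integral norm reduces the denominators of \<open>r\<close> and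
      \<open>s\<close> from 6 to 2.\<close>
    then have "R\<^sup>2 + T\<^sup>2 = 3 * (P\<^sup>2 + Q\<^sup>2 - 4 * K)" by simp
    then have "3 dvd R\<^sup>2 + T\<^sup>2" by simp
    from mod3_square_sum[OF this] obtain R' T' where RT: "R = 3 * R'" "T = 3 * T'"
      by (elim conjE dvdE)
    have "P\<^sup>2 + Q\<^sup>2 - 3 * R'\<^sup>2 - 3 * T'\<^sup>2 = 4 * K"
      using K by (simp add: RT power_mult_distrib)
    \<comment> \<open>Modulo 4 the four half-integer numerators get equal parity, which
      characterizes the span with (1+i+j+ij)/2.\<close>
    then have "4 dvd P\<^sup>2 + Q\<^sup>2 - 3 * R'\<^sup>2 - 3 * T'\<^sup>2" by simp
    from mod4_square_sum[OF this] obtain a b c where "P - T' = 2 * a" "Q - T' = 2 * b" "R' - T' = 2 * c"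
      by (elim conjE evenE)
    then have abc: "P = 2 * a + T'" "Q = 2 * b + T'" "R' = 2 * c + T'" by simp_all
    \<comment> \<open>The last coordinate is \<open>T'\<close>, since \<open>s = T' / 2\<close>; the
      second is \<open>- b - T'\<close> because \<open>Q\<close> stands for
      \<open>- 2 q\<close>.\<close>
    have "x = lat 1 1 a (- b - T') c T'" by (simp add: x coords RT abc lat_def field_simps)
    then show ?thesis by (simp only: lat_mem_ord)
  qed
  then show "S = ord 1 1" using S by blast
qed

section \<open>Sublattices of index three\<close>

text \<open>With w = (1+i+j+ij)/2, the last basis vector of \<open>ord 3 1\<close> is w + i, so its
  elements have i-coefficient \<open>3 b' + d\<close> with respect to 1, i, j, w.\<close>

lemma lat_mem_ord31: "lat 1 1 a b c d \<in> ord 3 1 \<longleftrightarrow> 3 dvd b - d"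
proof
  assume "lat 1 1 a b c d \<in> ord 3 1"
  then obtain a' b' c' d' where "lat 1 1 a b c d = lat 3 1 a' b' c' d'" unfolding ord_def by blast
  moreover have "lat 3 1 a' b' c' d' = lat 1 1 a' (3 * b' + d') c' d'" by (simp add: lat_def)
  ultimately have "d = d'" "b = 3 * b' + d'" by (auto simp: lat_def simp flip: of_int_mult of_int_add)
  then show "3 dvd b - d" by simp
next
  assume "3 dvd b - d"
  then obtain k where "b = 3 * k + d" by (metis dvdE diff_add_cancel)
  then have "lat 1 1 a b c d = lat 3 1 a k c d" by (simp add: lat_def)
  then show "lat 1 1 a b c d \<in> ord 3 1" by (simp only: lat_mem_ord)
qed

lemma ord31_subset: "ord 3 1 \<subseteq> ord 1 1"
proof -
  have "lat 3 1 a b c d = lat 1 1 a (3 * b + d) c d" for a b c d by (simp add: lat_def)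
  then show ?thesis unfolding ord_def by auto
qed

section \<open>Quotients of order three\<close>

lemma zbasis_zero:
  fixes b :: "'n::finite \<Rightarrow> b6"
  assumes "zbasis b L"
  shows "0 \<in> L"
  using zbasis_sum_mem[OF assms, of "\<lambda>_. 0"] by simp

lemma zbasis_add:
  fixes b :: "'n::finite \<Rightarrow> b6"
  assumes "zbasis b L" "x \<in> L" "y \<in> L"
  shows "x + y \<in> L"
  using zbasis_diff[OF assms(1) assms(2) zbasis_diff[OF assms(1) zbasis_zero[OF assms(1)] assms(3)]] by simp

lemma zbasis_smult:
  fixes b :: "'n::finite \<Rightarrow> b6"
  assumes "zbasis b L" "x \<in> L"
  shows "of_int n * x \<in> L"
  by (induction n rule: int_induct[where k = 0])
    (use assms in \<open>auto simp: distrib_right left_diff_distrib intro: zbasis_zero zbasis_add zbasis_diff\<close>)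

lemma coset_eq_iff:
  fixes b :: "'n::finite \<Rightarrow> b6"
  assumes L: "zbasis b L"
  shows "(+) x ` L = (+) y ` L \<longleftrightarrow> x - y \<in> L"
proof
  assume "(+) x ` L = (+) y ` L"
  moreover have "x \<in> (+) x ` L" using zbasis_zero[OF L] by (intro image_eqI[of _ _ 0]) auto
  ultimately show "x - y \<in> L" by auto
next
  assume xy: "x - y \<in> L"
  have "(+) u ` L \<subseteq> (+) v ` L" if "u - v \<in> L" for u v
  proof
    fix z assume "z \<in> (+) u ` L"
    then obtain l where "l \<in> L" "z = u + l" by auto
    then show "z \<in> (+) v ` L"
      using zbasis_add[OF L that] by (intro image_eqI[of _ _ "u - v + l"]) (auto simp: algebra_simps)
  qed
  moreover have "y - x \<in> L" using zbasis_diff[OF L zbasis_zero[OF L] xy] by simp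
  ultimately show "(+) x ` L = (+) y ` L" using xy by blast
qed

text \<open>An elementary form of the fact that M/L is cyclic of order 3: a nonzero class is not of
  order 2, and together with its double and 0 it exhausts the quotient.\<close>

lemma
  fixes b :: "'n::finite \<Rightarrow> b6" and b' :: "'m::finite \<Rightarrow> b6"
  assumes L: "zbasis b L" and M: "zbasis b' M" and idx: "lattice_index M L = 3"
    and x: "x \<in> M" "x \<notin> L"
  shows index_3_double: "x + x \<notin> L"
    and index_3_cosets: "\<And>y. y \<in> M \<Longrightarrow> y \<in> L \<or> y - x \<in> L \<or> y - (x + x) \<in> L"
proof -
  define C where "C u = (+) u ` L" for u
  have eq: "C u = C v \<longleftrightarrow> u - v \<in> L" for u v unfolding C_def by (rule coset_eq_iff[OF L])
  have card: "card (C ` M) = 3" using idx unfolding lattice_index_def C_def .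
  \<comment> \<open>An infinite set has \<open>card\<close> 0, so index 3 entails
    finiteness.\<close>
  then have fin: "finite (C ` M)" by (intro card_ge_0_finite) simp
  show xx: "x + x \<notin> L"
  proof
    assume xx: "x + x \<in> L"
    \<comment> \<open>If \<open>x\<close> had order 2, a class \<open>z\<close> outside {0, x} would
      give four distinct classes 0, x, z, z + x.\<close>
    have "card {C 0, C x} < 3" using card_insert_le_m1 by (auto simp: card_insert_if)
    then have "\<not> C ` M \<subseteq> {C 0, C x}" using card by (metis card_mono finite.emptyI finite.insertI not_le)
    then obtain z where "z \<in> M" "C z \<noteq> C 0" "C z \<noteq> C x" by blast
    then have z: "z \<in> M" "z \<notin> L" "z - x \<notin> L" by (simp_all add: eq)
    have zx: "z + x \<notin> L" using zbasis_diff[OF L _ xx, of "z + x"] z(3) by (auto simp: algebra_simps)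
    have "C x \<noteq> C 0" "C z \<noteq> C 0" "C (z + x) \<noteq> C 0" "C z \<noteq> C x" "C (z + x) \<noteq> C x" "C (z + x) \<noteq> C z"
      using x(2) z zx by (simp_all add: eq)
    then have "card {C (z + x), C z, C x, C 0} = 4" by simp
    moreover have "{C (z + x), C z, C x, C 0} \<subseteq> C ` M"
      using x z zbasis_zero[OF M] zbasis_add[OF M] by auto
    ultimately have "4 \<le> card (C ` M)" using card_mono[OF fin] by metis
    then show False using card by simp
  qed
  have "C x \<noteq> C 0" "C (x + x) \<noteq> C 0" "C (x + x) \<noteq> C x"
    using x(2) xx by (simp_all add: eq)
  then have "card {C (x + x), C x, C 0} = 3" by simp
  moreover have "{C (x + x), C x, C 0} \<subseteq> C ` M"
    using x zbasis_zero[OF M] zbasis_add[OF M] by auto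
  ultimately have "{C (x + x), C x, C 0} = C ` M" using card card_subset_eq[OF fin] by metis
  moreover fix y assume "y \<in> M"
  ultimately have "C y \<in> {C (x + x), C x, C 0}" by blast
  then show "y \<in> L \<or> y - x \<in> L \<or> y - (x + x) \<in> L" by (auto simp: eq)
qed

text \<open>Lagrange for M/L: if \<open>3 * x\<close> fell in the class of \<open>x\<close> or of
  \<open>x + x\<close>, then subtracting would put \<open>x + x\<close> or \<open>x\<close> in
  \<open>L\<close>.\<close>

lemma index_3_triple:
  fixes b :: "'n::finite \<Rightarrow> b6" and b' :: "'m::finite \<Rightarrow> b6"
  assumes L: "zbasis b L" and M: "zbasis b' M" and idx: "lattice_index M L = 3" and x: "x \<in> M"
  shows "3 * x \<in> L"
proof (cases "x \<in> L")
  case True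
  then show ?thesis using zbasis_smult[OF L, of x 3] by simp
next
  case False
  have "3 * x \<in> M" using zbasis_smult[OF M x, of 3] by simp
  moreover have "3 * x - x = x + x" "3 * x - (x + x) = x"
    by (simp_all add: numeral_b6 times_b6_def plus_b6_def minus_b6_def)
  ultimately show ?thesis
    using index_3_cosets[OF L M idx x False, of "3 * x"] index_3_double[OF L M idx x False] False
    by simp
qed

lemma index_3_proper:
  fixes b :: "'n::finite \<Rightarrow> b6"
  assumes L: "zbasis b L" and idx: "lattice_index M L = 3"
  shows "\<not> M \<subseteq> L"
proof
  assume "M \<subseteq> L"
  then have "(\<lambda>x. (+) x ` L) ` M \<subseteq> {(+) 0 ` L}" using coset_eq_iff[OF L, of _ 0] by auto
  from card_mono[OF _ this] show False using idx by (simp add: lattice_index_def)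
qed

text \<open>The prime 3 ramifies: modulo 3, the maximal order has a radical of dimension 2 with residue field
  of order 9, and an index-3 subring must be the preimage of the prime field.\<close>

lemma index_3_order_unique:
  assumes sub: "L \<subseteq> ord 1 1" and idx: "lattice_index (ord 1 1) L = 3" and L: "is_order L"
  shows "L = ord 3 1"
proof -
  obtain e :: "4 \<Rightarrow> b6" where e: "zbasis e L" using L by (auto simp: is_order_def)
  have M: "zbasis (ord_basis 1 1) (ord 1 1)" by (simp add: zbasis_ord)
  have mult: "x * y \<in> L" if "x \<in> L" "y \<in> L" for x y using L that by (auto simp: is_order_def)
  note add = zbasis_add[OF e] and diff = zbasis_diff[OF e] and smult = zbasis_smult[OF e]
  have one: "lat 1 1 a 0 0 0 \<in> L" for a
  proof -
    have "lat 1 1 a 0 0 0 = of_int a * 1" by (simp add: lat_def of_int_b6)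
    then show ?thesis using L smult[of 1 a] by (simp add: is_order_def)
  qed
  note triple = index_3_triple[OF e M idx]
  \<comment> \<open>Multiplication by \<open>n\<close> prime to 3 is invertible on the quotient,
    which is killed by 3.\<close>
  have prime: "x \<in> L" if "x \<in> ord 1 1" "of_int n * x \<in> L" "\<not> 3 dvd n" for x n
  proof -
    have "n mod 3 = 1 \<or> n mod 3 = 2" using that(3) by presburger
    then obtain k where "n = 3 * k + 1 \<or> n = 3 * k + 2" by (metis mult_div_mod_eq)
    then have "x = of_int n * x - of_int k * (3 * x) \<or>
        x = of_int (k + 1) * (3 * x) - of_int n * x"
      by (cases x) (auto simp: numeral_b6 of_int_mult_b6 times_b6_def minus_b6_def algebra_simps)
    then show ?thesis using diff smult triple that by metis
  qed
  have cosets: "\<exists>s\<in>{0, 1, 2 :: int}. y - of_int s * x \<in> L"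
    if "x \<in> ord 1 1" "y \<in> ord 1 1" "x \<notin> L" for x y
    using index_3_cosets[OF e M idx that(1,3,2)] by (simp add: mult_2)
  let ?i = "lat 1 1 0 1 0 0" and ?j = "lat 1 1 0 0 1 0" and ?w = "lat 1 1 0 0 0 1"
  have j: "?j \<in> L"
  proof (rule ccontr)
    assume nj: "?j \<notin> L"
    obtain s :: int where s: "s \<in> {0, 1, 2}" "?i - of_int s * ?j \<in> L"
      using cosets[OF lat_mem_ord lat_mem_ord nj] by blast
    obtain t :: int where t: "t \<in> {0, 1, 2}" "?w - of_int t * ?j \<in> L"
      using cosets[OF lat_mem_ord lat_mem_ord nj] by blast
    \<comment> \<open>\<open>?n\<close> is the coefficient of j left over when the product of the
      two elements of \<open>L\<close> is reduced by multiples of them and of 1. Modulo 3 it is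
      \<open>u^2 - u - 1\<close> with \<open>u = s + t\<close>, which has no root.\<close>
    let ?n = "2 * t - s - 1 + s\<^sup>2 + 2 * s * t - 2 * t\<^sup>2"
    have "of_int ?n * ?j = (?i - of_int s * ?j) * (?w - of_int t * ?j)
        + of_int (- (s + t)) * (?i - of_int s * ?j) + of_int (2 * t - s - 1) * (?w - of_int t * ?j)
        + lat 1 1 (1 - t + 2 * s - 3 * s * t) 0 0 0"
      unfolding of_int_mult_b6
      by (simp add: lat_def times_b6_def plus_b6_def minus_b6_def power2_eq_square algebra_simps)
    also have "\<dots> \<in> L" using s(2) t(2) by (intro add mult smult one)
    finally have "of_int ?n * ?j \<in> L" .
    moreover have "\<not> 3 dvd ?n" using s(1) t(1) by auto
    ultimately show False using prime[OF lat_mem_ord] nj by blast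
  qed
  \<comment> \<open>If i were in \<open>L\<close> along with j, then 2w = ij + i + j + 1 would put w
    there too, making \<open>L\<close> the whole order.\<close>
  have i: "?i \<notin> L"
  proof
    assume i: "?i \<in> L"
    have "2 * ?w = ?i * ?j + ?i + ?j + lat 1 1 1 0 0 0"
      by (simp add: numeral_b6 lat_def times_b6_def plus_b6_def)
    also have "\<dots> \<in> L" using i j by (intro add mult one)
    finally have "of_int 2 * ?w \<in> L" by simp
    from prime[OF lat_mem_ord this] have w: "?w \<in> L" by simp
    have "lat 1 1 a b c d \<in> L" for a b c d
    proof -
      have "lat 1 1 a b c d = of_int b * ?i + of_int c * ?j + of_int d * ?w + lat 1 1 a 0 0 0"
        unfolding of_int_mult_b6 by (simp add: lat_def plus_b6_def)
      also have "\<dots> \<in> L" using i j w by (intro add smult one)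
      finally show ?thesis .
    qed
    then have "ord 1 1 \<subseteq> L" unfolding ord_def by blast
    then show False using index_3_proper[OF e idx] by blast
  qed
  obtain s :: int where s: "s \<in> {0, 1, 2}" "?w - of_int s * ?i \<in> L"
    using cosets[OF lat_mem_ord lat_mem_ord i] by blast
  have "s = 2"
  proof (rule ccontr)
    assume "s \<noteq> 2"
    \<comment> \<open>Multiplying w - s i by j yields this multiple of i modulo \<open>L\<close>; it
      takes the values -1, -1, 3 at 0, 1, 2, so only \<open>s = 2\<close> survives.\<close>
    let ?n = "2 * s\<^sup>2 - 2 * s - 1"
    have "of_int ?n * ?i = ?j * (?w - of_int s * ?i) + of_int (1 - 2 * s) * (?w - of_int s * ?i)
        + of_int (s - 1) * ?j + lat 1 1 (s - 2) 0 0 0"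
      unfolding of_int_mult_b6
      by (simp add: lat_def times_b6_def plus_b6_def minus_b6_def power2_eq_square algebra_simps)
    also have "\<dots> \<in> L" using s(2) j by (intro add mult smult one)
    finally have "of_int ?n * ?i \<in> L" .
    moreover have "s \<in> {0, 1}" using s(1) \<open>s \<noteq> 2\<close> by auto
    then have "\<not> 3 dvd ?n" by auto
    ultimately show False using prime[OF lat_mem_ord] i by blast
  qed
  \<comment> \<open>Shifting w - 2i by 3i gives w + i, the half-integral basis vector of
    \<open>ord 3 1\<close>.\<close>
  have "lat 1 1 0 1 0 1 = ?w - of_int s * ?i + 3 * ?i"
    using \<open>s = 2\<close> by (simp add: numeral_b6 lat_def times_b6_def plus_b6_def minus_b6_def)
  also have "\<dots> \<in> L" using s(2) by (intro add triple lat_mem_ord)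
  finally have iw: "lat 1 1 0 1 0 1 \<in> L" .
  have "lat 1 1 a b c d \<in> L \<longleftrightarrow> 3 dvd b - d" for a b c d
  proof -
    have rest: "of_int c * ?j + of_int d * lat 1 1 0 1 0 1 + lat 1 1 a 0 0 0 \<in> L" (is "?r \<in> L")
      using j iw by (intro add smult one)
    \<comment> \<open>Modulo the elements 1, j, w + i of \<open>L\<close> only a multiple of i
      remains, and i has order 3 in the quotient.\<close>
    have eq: "lat 1 1 a b c d = of_int (b - d) * ?i + ?r"
      unfolding of_int_mult_b6
      by (simp add: lat_def plus_b6_def algebra_simps)
    show ?thesis
    proof
      assume "lat 1 1 a b c d \<in> L"
      then have "of_int (b - d) * ?i \<in> L" using diff[OF _ rest] eq by (metis add_diff_cancel_right')
      then show "3 dvd b - d" using prime[OF lat_mem_ord] i by blast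
    next
      assume "3 dvd b - d"
      then obtain k where k: "b - d = k * 3" by (metis dvdE mult.commute)
      have "of_int (b - d) * ?i = of_int k * (3 * ?i)" unfolding k by (simp add: mult.assoc)
      also have "\<dots> \<in> L" by (intro smult triple lat_mem_ord)
      finally have "of_int (b - d) * ?i \<in> L" .
      then show "lat 1 1 a b c d \<in> L" unfolding eq using rest by (rule add)
    qed
  qed
  then have "x \<in> L \<longleftrightarrow> x \<in> ord 3 1" if "x \<in> ord 1 1" for x
    using that lat_mem_ord31 unfolding ord_def[of 1 1] by fastforce
  then show ?thesis using sub ord31_subset by blast
qed

text \<open>The residue of \<open>b - d\<close> modulo 3 classifies the cosets, with representatives
  0, i, 2i.\<close>

lemma lattice_index_ord31: "lattice_index (ord 1 1) (ord 3 1) = 3"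
proof -
  define C where "C x = (+) x ` ord 3 1" for x
  let ?c = "\<lambda>k. C (lat 1 1 0 k 0 0)"
  have "zbasis (ord_basis 3 1) (ord 3 1)" by (simp add: zbasis_ord)
  then have eq: "C x = C y \<longleftrightarrow> x - y \<in> ord 3 1" for x y unfolding C_def by (rule coset_eq_iff)
  have "C x \<in> ?c ` {0, 1, 2}" if ord: "x \<in> ord 1 1" for x
  proof -
    obtain a b c d where x: "x = lat 1 1 a b c d" using ord unfolding ord_def by blast
    have "C x = ?c ((b - d) mod 3)" unfolding x eq lat_diff lat_mem_ord31 by presburger
    moreover have "(b - d) mod 3 \<in> {0, 1, 2}" by auto
    ultimately show ?thesis by (rule image_eqI)
  qed
  moreover have "?c k \<in> C ` ord 1 1" for k by (rule imageI) (rule lat_mem_ord)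
  ultimately have "C ` ord 1 1 = ?c ` {0, 1, 2}" by blast
  moreover have "inj_on ?c {0, 1, 2}"
    by (auto simp: inj_on_def eq lat_diff lat_mem_ord31)
  ultimately have "card (C ` ord 1 1) = 3" by (simp add: card_image)
  then show ?thesis unfolding lattice_index_def C_def .
qed

text \<open>\<open>zeta3\<close> has norm 1 and lies in \<open>ord 3 1\<close> together with its
  inverse, and conjugation by a unit of an order preserves that order.\<close>

lemma zeta3_conj_ord31: "(\<lambda>x. zeta3 * x * qinverse zeta3) ` ord 3 1 = ord 3 1"
proof -
  have z: "zeta3 = lat 3 1 (- 1) 0 0 1" "qinverse zeta3 = lat 3 1 0 0 0 (- 1)"
    by (simp_all add: zeta3_def numeral_b6 lat_def qinverse_def qconj_def nrd_def b6_of_rat_def qi_def qj_def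
        one_b6_def plus_b6_def uminus_b6_def times_b6_def power2_eq_square)
  have mem: "zeta3 \<in> ord 3 1" "qinverse zeta3 \<in> ord 3 1"
    using z lat_mem_ord by metis+
  have mult: "x * y \<in> ord 3 1" if "x \<in> ord 3 1" "y \<in> ord 3 1" for x y
    using is_order_ord[of 3 1] that unfolding is_order_def by simp
  have "nrd zeta3 \<noteq> 0" by (simp add: z lat_def nrd_def power2_eq_square)
  note inv = qinverse[OF this]
  have x: "x = zeta3 * (qinverse zeta3 * x * zeta3) * qinverse zeta3" for x
  proof -
    have "zeta3 * (qinverse zeta3 * x * zeta3) * qinverse zeta3
        = (zeta3 * qinverse zeta3) * x * (zeta3 * qinverse zeta3)" by (simp only: mult.assoc)
    then show ?thesis by (simp add: inv)
  qed
  show ?thesis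
  proof
    show "(\<lambda>x. zeta3 * x * qinverse zeta3) ` ord 3 1 \<subseteq> ord 3 1" using mem mult by blast
    show "ord 3 1 \<subseteq> (\<lambda>x. zeta3 * x * qinverse zeta3) ` ord 3 1"
    proof
      fix y assume "y \<in> ord 3 1"
      then have "qinverse zeta3 * y * zeta3 \<in> ord 3 1" by (intro mult mem)
      with x show "y \<in> (\<lambda>x. zeta3 * x * qinverse zeta3) ` ord 3 1" by (rule image_eqI)
    qed
  qed
qed

theorem theorem3p2:
  shows
    "is_maximal_order O61
     \<and> \<comment> \<open>(a)\<close>
     (\<exists>!L. L \<subseteq> O61 \<and> lattice_index O61 L = 3 \<and> is_order L \<and> discrd L = 18)
     \<and> (\<lambda>x. zeta3 * x * qinverse zeta3) ` O63 = O63
     \<and> \<comment> \<open>(b)\<close>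
     is_order O61' \<and> discrd O61' = 12
     \<and> is_order O63' \<and> discrd O63' = 36
     \<and> \<comment> \<open>(c)\<close>
     discrd O61 = 6 \<and> discrd O63 = 18
     \<and> even_ternary_in_genus (dual0 O61) (- of_nat (discrd O61)) G1
     \<and> even_ternary_in_genus (dual0 O63) (- of_nat (discrd O63)) G2
     \<and> even_ternary_in_genus (dual0 O61') (- of_nat (discrd O61')) G3
     \<and> even_ternary_in_genus (dual0 O63') (- of_nat (discrd O63')) G4"
proof -
  have ex1: "\<exists>!L. L \<subseteq> O61 \<and> lattice_index O61 L = 3 \<and> is_order L \<and> discrd L = 18"
    unfolding O61_eq
  proof (rule ex1I)
    show "ord 3 1 \<subseteq> ord 1 1 \<and> lattice_index (ord 1 1) (ord 3 1) = 3 \<and> is_order (ord 3 1)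
        \<and> discrd (ord 3 1) = 18"
      by (simp add: ord31_subset lattice_index_ord31 is_order_ord discrd_ord)
  qed (use index_3_order_unique in blast)
  have O63: "O63 = ord 3 1"
  proof -
    \<comment> \<open>Unique existence gives the definite description its defining properties; the
      classification of index-3 orders then identifies it.\<close>
    have "O63 \<subseteq> O61 \<and> lattice_index O61 O63 = 3 \<and> is_order O63 \<and> discrd O63 = 18"
      unfolding O63_def by (rule theI'[OF ex1])
    then show ?thesis unfolding O61_eq using index_3_order_unique by blast
  qed
  note eqs = O61_eq O63 even_trd_ord
  show ?thesis
    using ex1 is_maximal_order_ord zeta3_conj_ord31 genus_G1 genus_G2 genus_G3 genus_G4
    unfolding eqs by (simp add: is_order_ord discrd_ord)
qed

end
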